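(* For all sufficiently large integers $n$, there exists an $n\times n$ array filled with the symbols $1,\dots,n$ such that each symbol occurs exactly $n$ times in the array, and such that the array has no partial transversal of size larger than $n-\frac{1}{42}\ln n$.
   Context: A partial transversal of an $n\times n$ array is a collection of cells of the array no two of which share the same row, the same column, or the same symbol; its size is the number of cells in it. Symbols may repeat within rows and columns of the array. *)

theory Defs
  imports Complex_Main
begin

text \<open>
  An array assigns the symbol \<open>A i j\<close> to the cell \<open>(i, j)\<close>. Rows, columns and symbols
  of an \<open>n \<times> n\<close> array are numbered from \<open>1\<close> to \<open>n\<close>; values of \<open>A\<close> outside
  \<open>{1..n} \<times> {1..n}\<close> are irrelevant.
\<close>

type_synonym array = "nat \<Rightarrow> nat \<Rightarrow> nat"

definition cells :: "nat \<Rightarrow> (nat \<times> nat) set" where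
  "cells n = {1..n} \<times> {1..n}"

definition filled_with_symbols :: "nat \<Rightarrow> array \<Rightarrow> bool" where
  "filled_with_symbols n A \<longleftrightarrow> (\<forall>(i, j) \<in> cells n. A i j \<in> {1..n})"

definition occurrences :: "nat \<Rightarrow> array \<Rightarrow> nat \<Rightarrow> nat" where
  "occurrences n A s = card {(i, j) \<in> cells n. A i j = s}"

definition equi_n_square :: "nat \<Rightarrow> array \<Rightarrow> bool" where
  "equi_n_square n A \<longleftrightarrow>
     filled_with_symbols n A \<and> (\<forall>s \<in> {1..n}. occurrences n A s = n)"

definition partial_transversal :: "nat \<Rightarrow> array \<Rightarrow> (nat \<times> nat) set \<Rightarrow> bool" where
  "partial_transversal n A T \<longleftrightarrow>
     T \<subseteq> cells n \<and>
     (\<forall>(i, j) \<in> T. \<forall>(i', j') \<in> T. (i, j) \<noteq> (i', j') \<longrightarrow>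
        i \<noteq> i' \<and> j \<noteq> j' \<and> A i j \<noteq> A i' j')"

end

theory Submission
  imports Defs "HOL-Real_Asymp.Real_Asymp"
begin

text \<open>
  The obstruction is a family of parity constraints. Fix \<open>d\<close> and give every row, every column
  and every symbol a label, a set of at most two elements of \<open>{..<d}\<close>; labels are added by
  symmetric difference, so they form the group \<open>(\<int>/2)\<^sup>d\<close>. Suppose that in every cell outside a
  single exceptional row \<open>q\<close> the label of the symbol is the sum of the labels of its row and its
  column, and that every \<open>a < d\<close> occurs in an odd total number of labels of rows, columns and
  symbols. A partial transversal that meets all rows, columns and symbols with \<open>a\<close> in their label
  sees this odd number, while each of its cells outside row \<open>q\<close> contributes an even number.
  Hence for every \<open>a\<close> the transversal misses a row, column or symbol whose label contains \<open>a\<close>,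
  or its only cell in row \<open>q\<close> violates the constraint for \<open>a\<close>. As labels have size at most
  \<open>1\<close>, \<open>1\<close> and \<open>2\<close>, a transversal of size \<open>n - t\<close> deals with at most \<open>4 t + 3\<close> values of \<open>a\<close>,
  which gives \<open>d \<le> 4 t + 3\<close> (lemma \<open>transversal_deficiency\<close>).

  The array is found by counting. The exceptional row can absorb any discrepancy, so a filling
  with every symbol used \<open>n\<close> times exists as soon as, for each label \<open>K\<close>, the cells outside row
  \<open>q\<close> that require label \<open>K\<close> number at most \<open>n\<close> times the symbols with label \<open>K\<close> (lemma
  \<open>exists_balanced_labelled_filling\<close>). For each \<open>a < d\<close> let \<open>d\<close> rows and \<open>c = n div (2 * d)\<close>
  columns have the label \<open>{a}\<close>, and let all others have the label \<open>{}\<close>. The label \<open>{a, b}\<close> is then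
  required by \<open>2 d c\<close> cells, which is at most \<open>n\<close> and close to it, so one symbol suffices for it. The label
  \<open>{a}\<close> is required by about \<open>(d + c) n - 2 c d\<^sup>2\<close> cells, that is about \<open>c n\<close>, and gets \<open>c\<close> symbols.
  So \<open>a\<close> occurs in \<open>d + c + (c + (d - 1))\<close> labels, an odd number. The rounding errors are
  harmless when \<open>4 d\<^sup>3 \<le> n\<close> (lemma \<open>card_cells_with_label\<close>), so the deficiency can grow like the
  cube root of \<open>n\<close>; taking \<open>d\<close> close to \<open>ln n\<close> is more than enough for the theorem.
\<close>

section \<open>Functions and fillings with prescribed fibres\<close>

lemma card_filter_inj_on:
  assumes "inj_on f T" "f ` T \<subseteq> S" "\<And>s. s \<in> S \<Longrightarrow> P s \<Longrightarrow> s \<in> f ` T"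
  shows "card {x \<in> T. P (f x)} = card {s \<in> S. P s}"
proof -
  have "f ` {x \<in> T. P (f x)} = {s \<in> S. P s}" using assms(2,3) by blast
  moreover have "inj_on f {x \<in> T. P (f x)}" using assms(1) by (auto simp: inj_on_def)
  ultimately show ?thesis using card_image by metis
qed

lemma card_UN_le_mult:
  assumes "finite I" "\<And>i. i \<in> I \<Longrightarrow> card (f i) \<le> b"
  shows "card (\<Union>i\<in>I. f i) \<le> card I * b"
  using card_UN_le[OF assms(1), of f] sum_bounded_above[of I "\<lambda>i. card (f i)" b] assms(2)
  by force

lemma exists_fun_with_fibre_cards:
  assumes "finite X" "finite L" "(\<Sum>l\<in>L. f l) = card X"
  shows "\<exists>g. g ` X \<subseteq> L \<and> (\<forall>l\<in>L. card {x \<in> X. g x = l} = f l)"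
proof -
  let ?Y = "SIGMA l:L. {..<f l}"
  have "finite ?Y" "card ?Y = card X"
    using assms by auto
  then obtain h where h: "bij_betw h X ?Y"
    using finite_same_card_bij[OF assms(1), of ?Y] by auto
  have "card {x \<in> X. fst (h x) = l} = f l" if "l \<in> L" for l
  proof -
    have "card {x \<in> X. fst (h x) = l} = card {y \<in> ?Y. fst y = l}"
      using h by (intro card_filter_inj_on) (auto simp: bij_betw_def)
    also have "{y \<in> ?Y. fst y = l} = {l} \<times> {..<f l}" using that by auto
    finally show ?thesis by simp
  qed
  moreover have "(\<lambda>x. fst (h x)) ` X \<subseteq> L"
    using bij_betwE[OF h] by auto
  ultimately show ?thesis by blast
qed

text \<open>
  Each symbol offers \<open>n\<close> slots. The cells in \<open>X0\<close>, on which the label of the symbol is prescribed,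
  are first injected into slots of the right label; as there are as many slots as cells, the
  injection extends to a bijection, and the remaining cells take whatever slots are left.
\<close>

lemma exists_balanced_labelled_filling:
  fixes X :: "'x set" and S :: "'s set" and lab :: "'x \<Rightarrow> 'k" and m :: "'s \<Rightarrow> 'k"
  assumes fin: "finite X" "finite S" and sub: "X0 \<subseteq> X"
    and total: "card X = card S * n"
    and room: "\<And>k. card {x \<in> X0. lab x = k} \<le> card {s \<in> S. m s = k} * n"
  shows "\<exists>A. A ` X \<subseteq> S \<and> (\<forall>s\<in>S. card {x \<in> X. A x = s} = n) \<and> (\<forall>x\<in>X0. m (A x) = lab x)"
proof -
  let ?Y = "S \<times> {..<n}"
  have fin0: "finite X0" using fin sub finite_subset by blast
  have "\<exists>h. h ` {x \<in> X0. lab x = k} \<subseteq> {s \<in> S. m s = k} \<times> {..<n} \<and> inj_on h {x \<in> X0. lab x = k}" for k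
    using room[of k] fin fin0 by (intro card_le_inj) auto
  hence "\<forall>k. \<exists>h. h ` {x \<in> X0. lab x = k} \<subseteq> {s \<in> S. m s = k} \<times> {..<n} \<and> inj_on h {x \<in> X0. lab x = k}"
    by (rule allI)
  from choice[OF this] obtain H
    where H: "\<And>k. H k ` {x \<in> X0. lab x = k} \<subseteq> {s \<in> S. m s = k} \<times> {..<n}"
      and Hinj: "\<And>k. inj_on (H k) {x \<in> X0. lab x = k}" by blast
  define h where "h = (\<lambda>x. H (lab x) x)"
  have hY: "h x \<in> ?Y" "m (fst (h x)) = lab x" if "x \<in> X0" for x
    using H[of "lab x"] that unfolding h_def by auto
  have hinj: "inj_on h X0"
  proof (rule inj_onI)
    fix x y assume xy: "x \<in> X0" "y \<in> X0" "h x = h y"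
    hence "lab x = lab y" using hY(2) by metis
    thus "x = y" using xy Hinj[of "lab y"] unfolding h_def inj_on_def by auto
  qed
  have hsub: "h ` X0 \<subseteq> ?Y" using hY(1) by blast
  have "card (X - X0) = card (?Y - h ` X0)"
    using fin0 sub total hsub hinj by (simp add: card_Diff_subset card_image card_cartesian_product)
  then obtain g where g: "bij_betw g (X - X0) (?Y - h ` X0)"
    using finite_same_card_bij[of "X - X0" "?Y - h ` X0"] fin by auto
  define F where "F = (\<lambda>x. if x \<in> X0 then h x else g x)"
  have "bij_betw F (X0 \<union> (X - X0)) (h ` X0 \<union> (?Y - h ` X0))"
  proof (rule bij_betw_combine)
    show "bij_betw F X0 (h ` X0)"
      using hinj by (auto simp: F_def bij_betw_def inj_on_def)
    show "bij_betw F (X - X0) (?Y - h ` X0)"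
      using g by (subst bij_betw_cong[of _ _ g]) (auto simp: F_def)
  qed auto
  moreover have "X0 \<union> (X - X0) = X" "h ` X0 \<union> (?Y - h ` X0) = ?Y"
    using sub hsub by auto
  ultimately have F: "bij_betw F X ?Y" by simp
  have "card {x \<in> X. fst (F x) = s} = n" if "s \<in> S" for s
  proof -
    have "card {x \<in> X. fst (F x) = s} = card {y \<in> ?Y. fst y = s}"
      using F by (intro card_filter_inj_on) (auto simp: bij_betw_def)
    also have "{y \<in> ?Y. fst y = s} = {s} \<times> {..<n}" using that by auto
    finally show ?thesis by simp
  qed
  moreover have "(\<lambda>x. fst (F x)) ` X \<subseteq> S"
    using bij_betwE[OF F] by auto
  moreover have "m (fst (F x)) = lab x" if "x \<in> X0" for x
    using hY that by (simp add: F_def)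
  ultimately show ?thesis by blast
qed

section \<open>Labels\<close>

definition labels :: "nat \<Rightarrow> nat \<Rightarrow> nat set set" where
  "labels d k = {K. K \<subseteq> {..<d} \<and> card K = k}"

lemma labels_0: "labels d 0 = {{}}"
  unfolding labels_def by (auto dest: finite_subset[OF _ finite_lessThan])

lemma finite_labels: "finite (labels d k)"
  unfolding labels_def by auto

lemma card_labels: "card (labels d k) = d choose k"
  unfolding labels_def by (simp add: n_subsets)

lemma labels_1: "labels d (Suc 0) = (\<lambda>a. {a}) ` {..<d}"
  unfolding labels_def by (auto simp: card_1_singleton_iff)

lemma card_pairs_containing:
  assumes "a < d"
  shows "card {K \<in> labels d 2. a \<in> K} = d - 1"
proof -
  have "{K \<in> labels d 2. a \<in> K} = (\<lambda>b. {a, b}) ` ({..<d} - {a})"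
    using assms by (auto simp: labels_def card_2_iff)
  moreover have "inj_on (\<lambda>b. {a, b}) ({..<d} - {a})"
    by (auto simp: inj_on_def doubleton_eq_iff)
  ultimately show ?thesis using assms by (simp add: card_image)
qed

text \<open>
  The parameters \<open>p\<close> and \<open>e\<close> are the multiplicities of the labels of size \<open>1\<close> and \<open>2\<close>; rows and
  columns use \<open>e = 0\<close>, symbols use \<open>e = 1\<close>.
\<close>

definition labelling :: "nat \<Rightarrow> nat \<Rightarrow> nat \<Rightarrow> nat \<Rightarrow> (nat \<Rightarrow> nat set) \<Rightarrow> bool" where
  "labelling n d p e g \<longleftrightarrow> g ` {1..n} \<subseteq> labels d 0 \<union> labels d 1 \<union> labels d 2
      \<and> card {x \<in> {1..n}. g x = {}} = n - (d * p + (d choose 2) * e)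
      \<and> (\<forall>K\<in>labels d 1. card {x \<in> {1..n}. g x = K} = p)
      \<and> (\<forall>K\<in>labels d 2. card {x \<in> {1..n}. g x = K} = e)"

lemma exists_labelling:
  assumes "d * p + (d choose 2) * e \<le> n"
  shows "\<exists>g. labelling n d p e g"
proof -
  define f where "f = (\<lambda>K::nat set. if card K = 0 then n - (d * p + (d choose 2) * e)
     else if card K = 1 then p else e)"
  let ?L = "labels d 0 \<union> labels d 1 \<union> labels d 2"
  have f: "\<And>K. K \<in> labels d 0 \<Longrightarrow> f K = n - (d * p + (d choose 2) * e)"
      "\<And>K. K \<in> labels d 1 \<Longrightarrow> f K = p" "\<And>K. K \<in> labels d 2 \<Longrightarrow> f K = e"
    by (auto simp: labels_def f_def)
  have "sum f ?L = sum f (labels d 0) + sum f (labels d 1) + sum f (labels d 2)"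
    by (subst sum.union_disjoint, auto simp: finite_labels labels_def)+
  also have "\<dots> = n"
    using assms by (simp add: f card_labels)
  finally have "sum f ?L = card {1..n}" by simp
  from exists_fun_with_fibre_cards[OF _ _ this]
  obtain g where g: "g ` {1..n} \<subseteq> ?L" "\<forall>K\<in>?L. card {x \<in> {1..n}. g x = K} = f K"
    by (auto simp: finite_labels)
  have "card {x \<in> {1..n}. g x = {}} = f {}"
    using g(2) labels_0[of d] by blast
  thus ?thesis
    using g f labels_0[of d] unfolding labelling_def by (intro exI[of _ g]) auto
qed

lemma labelling_card_containing:
  assumes g: "labelling n d p e g" and a: "a < d"
  shows "card {x \<in> {1..n}. a \<in> g x} = p + (d - 1) * e"
proof -
  let ?F = "\<lambda>K. {x \<in> {1..n}. g x = K}"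
  let ?P = "{K \<in> labels d 2. a \<in> K}"
  have a1: "{a} \<in> labels d 1" using a by (auto simp: labels_1)
  have "{x \<in> {1..n}. a \<in> g x} = (\<Union>K\<in>insert {a} ?P. ?F K)"
  proof (intro equalityI subsetI)
    fix x assume x: "x \<in> {x \<in> {1..n}. a \<in> g x}"
    hence "g x \<in> labels d 0 \<union> labels d 1 \<union> labels d 2"
      using g unfolding labelling_def by blast
    thus "x \<in> (\<Union>K\<in>insert {a} ?P. ?F K)"
      using x by (auto simp: labels_0 labels_1)
  qed auto
  also have "card \<dots> = (\<Sum>K\<in>insert {a} ?P. card (?F K))"
    by (rule card_UN_disjoint) (auto simp: finite_labels)
  also have "\<dots> = card (?F {a}) + (\<Sum>K\<in>?P. card (?F K))"
    by (rule sum.insert) (auto simp: finite_labels labels_def)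
  also have "\<dots> = p + (\<Sum>K\<in>?P. e)"
    using g a1 by (auto simp: labelling_def intro!: sum.cong)
  finally show ?thesis using card_pairs_containing[OF a] by simp
qed

lemma labelling_cases:
  assumes "labelling n d p e g" "x \<in> {1..n}"
  obtains "g x = {}" | a where "a < d" "g x = {a}"
    | a b where "a < d" "b < d" "a \<noteq> b" "g x = {a, b}" "e \<noteq> 0"
proof -
  have x: "g x \<in> labels d 0 \<union> labels d 1 \<union> labels d 2"
    using assms unfolding labelling_def by blast
  have "e \<noteq> 0" if "g x \<in> labels d 2"
  proof -
    have "0 < card {y \<in> {1..n}. g y = g x}"
      using assms(2) by (auto simp: card_gt_0_iff)
    moreover have "card {y \<in> {1..n}. g y = g x} = e"
      using that assms(1) unfolding labelling_def by blast
    ultimately show ?thesis by simp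
  qed
  thus ?thesis using x that
    by (auto simp: labels_0 labels_1) (auto simp: labels_def card_2_iff)
qed

lemma labelling_0_cases:
  assumes "labelling n d p 0 g" "x \<in> {1..n}"
  shows "g x = {} \<or> (\<exists>a<d. g x = {a})"
  using assms by (rule labelling_cases) auto

section \<open>The parity obstruction\<close>

text \<open>
  The right-hand side counts the elements of \<open>{..<d}\<close> that can escape the parity argument: with
  \<open>t = n - card T\<close>, those in the labels of the \<open>t\<close> missed rows, the \<open>t\<close> missed columns and the \<open>t\<close>
  missed symbols number at most \<open>t + t + 2 * t\<close>, and those in the labels of the column and the
  symbol of the cell of \<open>T\<close> in row \<open>q\<close> number at most \<open>1 + 2\<close>.
\<close>

lemma transversal_deficiency:
  fixes rl cl sl :: "nat \<Rightarrow> nat set"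
  assumes T: "partial_transversal n A T" and filled: "filled_with_symbols n A"
    and q: "rl q = {}"
    and rows: "\<And>i. i \<in> {1..n} \<Longrightarrow> finite (rl i) \<and> card (rl i) \<le> 1"
    and cols: "\<And>j. j \<in> {1..n} \<Longrightarrow> finite (cl j) \<and> card (cl j) \<le> 1"
    and syms: "\<And>s. s \<in> {1..n} \<Longrightarrow> finite (sl s) \<and> card (sl s) \<le> 2"
    and cell: "\<And>i j. i \<in> {1..n} \<Longrightarrow> j \<in> {1..n} \<Longrightarrow> i \<noteq> q \<Longrightarrow> sl (A i j) = sym_diff (rl i) (cl j)"
    and parity: "\<And>a. a < d \<Longrightarrow> odd (card {i \<in> {1..n}. a \<in> rl i} + card {j \<in> {1..n}. a \<in> cl j}
                   + card {s \<in> {1..n}. a \<in> sl s})"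
  shows "d \<le> 4 * (n - card T) + 3"
proof -
  have Tsub: "T \<subseteq> {1..n} \<times> {1..n}"
    using T by (simp add: partial_transversal_def cells_def)
  hence finT: "finite T" using finite_subset by blast
  let ?sym = "\<lambda>x. A (fst x) (snd x)"
  have inj: "inj_on fst T" "inj_on snd T" "inj_on ?sym T"
    using T unfolding partial_transversal_def inj_on_def by fastforce+
  have img: "fst ` T \<subseteq> {1..n}" "snd ` T \<subseteq> {1..n}" "?sym ` T \<subseteq> {1..n}"
    using Tsub filled unfolding filled_with_symbols_def cells_def by fastforce+
  define miss where "miss = (\<lambda>f::nat \<times> nat \<Rightarrow> nat. {1..n} - f ` T)"
  have miss: "finite (miss f)" "miss f \<subseteq> {1..n}" for f
    by (auto simp: miss_def)
  have card_miss: "card (miss f) = n - card T" if "inj_on f T" "f ` T \<subseteq> {1..n}" for f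
    using that finT by (simp add: miss_def card_Diff_subset card_image)
  define Q where "Q = {x \<in> T. fst x = q}"
  have Q: "card Q \<le> 1" "finite Q"
  proof -
    have "inj_on fst Q" using inj(1) by (auto simp: Q_def inj_on_def)
    hence "card Q = card (fst ` Q)" by (simp add: card_image)
    also have "\<dots> \<le> card {q}" by (rule card_mono) (auto simp: Q_def)
    finally show "card Q \<le> 1" by simp
    show "finite Q" using finT by (simp add: Q_def)
  qed
  define B where "B = (\<Union>x\<in>Q. cl (snd x) \<union> sl (?sym x))"
  have "{..<d} \<subseteq> (\<Union>i\<in>miss fst. rl i) \<union> (\<Union>j\<in>miss snd. cl j) \<union> (\<Union>s\<in>miss ?sym. sl s) \<union> B"
    (is "_ \<subseteq> ?U")
  proof (rule ccontr)
    assume "\<not> {..<d} \<subseteq> ?U"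
    then obtain a where a: "a < d" and na: "a \<notin> ?U" unfolding subset_iff lessThan_iff by blast
    \<comment> \<open>Nothing labelled with \<open>a\<close> is missed, so counting along \<open>T\<close> gives the odd total of \<open>parity\<close>.\<close>
    let ?r = "{x \<in> T. a \<in> rl (fst x)}" and ?c = "{x \<in> T. a \<in> cl (snd x)}"
      and ?s = "{x \<in> T. a \<in> sl (?sym x)}"
    have "card ?r = card {i \<in> {1..n}. a \<in> rl i}"
      using na img by (intro card_filter_inj_on inj) (auto simp: miss_def)
    moreover have "card ?c = card {i \<in> {1..n}. a \<in> cl i}"
      using na img by (intro card_filter_inj_on inj) (auto simp: miss_def)
    moreover have "card ?s = card {i \<in> {1..n}. a \<in> sl i}"
      using na img by (intro card_filter_inj_on[of ?sym T _ "\<lambda>s. a \<in> sl s"] inj) (auto simp: miss_def)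
    ultimately have "odd (card ?r + card ?c + card ?s)"
      using parity[OF a] by simp
    moreover have "?s = sym_diff ?r ?c"
    proof -
      have "a \<in> sl (?sym x) \<longleftrightarrow> a \<in> sym_diff (rl (fst x)) (cl (snd x))" if x: "x \<in> T" for x
      proof (cases "fst x = q")
        case True
        \<comment> \<open>Here \<open>a\<close> lies in none of the three labels, as \<open>a \<notin> B\<close> and row \<open>q\<close> has the empty label.\<close>
        with na x q show ?thesis unfolding B_def Q_def by auto
      next
        case False
        moreover have "fst x \<in> {1..n}" "snd x \<in> {1..n}" using x Tsub by auto
        ultimately show ?thesis using cell by metis
      qed
      thus ?thesis by auto
    qed
    hence "card ?s + 2 * card (?r \<inter> ?c) = card ?r + card ?c"
    proof -
      assume s: "?s = sym_diff ?r ?c"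
      have fin: "finite ?r" "finite ?c" using finT by auto
      have "card ?s = card (?r - ?c) + card (?c - ?r)"
        unfolding s using fin by (intro card_Un_disjoint) auto
      moreover have "card ?r = card (?r - ?c) + card (?r \<inter> ?c)"
        using card_Diff_subset_Int[of ?r ?c] card_mono[of ?r "?r \<inter> ?c"] fin by simp
      moreover have "card ?c = card (?c - ?r) + card (?r \<inter> ?c)"
        using card_Diff_subset_Int[of ?c ?r] card_mono[of ?c "?r \<inter> ?c"] fin by (simp add: Int_commute)
      ultimately show ?thesis by simp
    qed
    ultimately show False by presburger
  qed
  moreover have finU: "finite ?U"
  proof -
    have "finite B" unfolding B_def
    proof (rule finite_UN_I[OF Q(2)])
      fix x assume "x \<in> Q"
      hence "snd x \<in> {1..n}" "?sym x \<in> {1..n}" using img by (auto simp: Q_def)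
      thus "finite (cl (snd x) \<union> sl (?sym x))" using cols syms by blast
    qed
    moreover have "finite (\<Union>i\<in>miss fst. rl i)" using miss rows by (intro finite_UN_I) blast+
    moreover have "finite (\<Union>i\<in>miss snd. cl i)" using miss cols by (intro finite_UN_I) blast+
    moreover have "finite (\<Union>i\<in>miss ?sym. sl i)" using miss syms by (intro finite_UN_I) blast+
    ultimately show ?thesis by blast
  qed
  ultimately have "card {..<d} \<le> card ?U" by (intro card_mono)
  hence "d \<le> card ?U" by (simp only: card_lessThan)
  moreover have "card ?U \<le> card (\<Union>i\<in>miss fst. rl i) + card (\<Union>j\<in>miss snd. cl j)
      + card (\<Union>s\<in>miss ?sym. sl s) + card B"
    by (intro order_trans[OF card_Un_le] add_right_mono order_refl)
  moreover have "card (\<Union>i\<in>miss fst. rl i) \<le> card (miss fst) * 1"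
    using miss rows by (intro card_UN_le_mult) blast+
  moreover have "card (\<Union>i\<in>miss snd. cl i) \<le> card (miss snd) * 1"
    using miss cols by (intro card_UN_le_mult) blast+
  moreover have "card (\<Union>i\<in>miss ?sym. sl i) \<le> card (miss ?sym) * 2"
    using miss syms by (intro card_UN_le_mult) blast+
  moreover have "card B \<le> card Q * 3" unfolding B_def
  proof (rule card_UN_le_mult[OF Q(2)])
    fix x assume "x \<in> Q"
    hence "snd x \<in> {1..n}" "?sym x \<in> {1..n}" using img by (auto simp: Q_def)
    hence "card (cl (snd x)) \<le> 1" "card (sl (?sym x)) \<le> 2" using cols syms by blast+
    thus "card (cl (snd x) \<union> sl (?sym x)) \<le> 3"
      using card_Un_le[of "cl (snd x)" "sl (?sym x)"] by linarith
  qed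
  ultimately show ?thesis
    using Q(1) card_miss[OF inj(1) img(1)] card_miss[OF inj(2) img(2)] card_miss[OF inj(3) img(3)]
    by linarith
qed

section \<open>The array\<close>

text \<open>
  This is the numerical heart of the construction: \<open>2 * (d * c)\<close> approximates \<open>n\<close> from below.
  For labels of size \<open>2\<close> the approximation from below is what is needed. For \<open>{a}\<close> the error of at
  most \<open>2 * d\<close>, made once for each of the \<open>d\<close> blocks, works in the wrong direction; it is paid for by
  the \<open>c\<close> cells of row \<open>q\<close> in the columns labelled \<open>{a}\<close>, whence \<open>2 * (d * d) \<le> c\<close>.
\<close>

lemma card_cells_with_label:
  fixes d c n q :: nat and rl cl sl :: "nat \<Rightarrow> nat set"
  assumes c: "2 * (d * c) \<le> n" "n \<le> 2 * (d * c) + 2 * d" "2 * (d * d) \<le> c"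
    and d: "d * d < n" and sum: "d * c + (d choose 2) \<le> n"
    and rl: "labelling n d d 0 rl" and cl: "labelling n d c 0 cl" and sl: "labelling n d c 1 sl"
    and q: "q \<in> {1..n}" "rl q = {}"
  shows "card {x \<in> ({1..n} - {q}) \<times> {1..n}. sym_diff (rl (fst x)) (cl (snd x)) = k}
    \<le> card {s \<in> {1..n}. sl s = k} * n"
    (is "card ?N \<le> _")
proof -
  define R where "R = (\<lambda>k. {i \<in> {1..n} - {q}. rl i = k})"
  define C where "C = (\<lambda>k. {j \<in> {1..n}. cl j = k})"
  have fin: "finite (R k)" "finite (C k)" for k by (auto simp: R_def C_def)
  have N: "\<exists>K L. fst x \<in> R K \<and> snd x \<in> C L \<and> sym_diff K L = k" if "x \<in> ?N" for x
    using that by (auto simp: R_def C_def)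
  have RK: "K = {} \<or> (\<exists>a<d. K = {a})" if "i \<in> R K" for i K
    using labelling_0_cases[OF rl, of i] that by (simp add: R_def)
  have CK: "K = {} \<or> (\<exists>a<d. K = {a})" if "i \<in> C K" for i K
    using labelling_0_cases[OF cl, of i] that by (simp add: C_def)
  have R0: "card (R {}) = n - d * d - 1"
  proof -
    have "R {} = {i \<in> {1..n}. rl i = {}} - {q}" by (auto simp: R_def)
    thus ?thesis using q rl by (simp add: labelling_def)
  qed
  have Ra: "card (R {a}) = d" if "a < d" for a
  proof -
    have "R {a} = {i \<in> {1..n}. rl i = {a}}" using q by (auto simp: R_def)
    thus ?thesis using that rl by (auto simp: labelling_def labels_1)
  qed
  have C0: "card (C {}) = n - d * c"
    using cl by (simp add: labelling_def C_def)
  have Ca: "card (C {a}) = c" if "a < d" for a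
    using that cl by (auto simp: labelling_def labels_1 C_def)
  consider "k = {}" | a where "a < d" "k = {a}" | a b where "a < d" "b < d" "a \<noteq> b" "k = {a, b}"
    | "?N = {}"
  proof (cases "?N = {}")
    case False
    then obtain x where "x \<in> ?N" by blast
    from N[OF this] obtain K L where "fst x \<in> R K" "snd x \<in> C L" "sym_diff K L = k" by blast
    from RK[OF this(1)] CK[OF this(2)] this(3) that show ?thesis
      by (elim disjE exE conjE) (auto split: if_splits)
  qed
  thus ?thesis
  proof cases
    case 1
    have "?N \<subseteq> R {} \<times> C {} \<union> (\<Union>a\<in>{..<d}. R {a} \<times> C {a})"
    proof
      fix x assume xN: "x \<in> ?N"
      obtain K L where x: "fst x \<in> R K" "snd x \<in> C L" and "sym_diff K L = {}"
        using N[OF xN] unfolding 1 by blast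
      hence "L = K" by blast
      thus "x \<in> R {} \<times> C {} \<union> (\<Union>a\<in>{..<d}. R {a} \<times> C {a})"
        using RK[OF x(1)] x by (cases x) auto
    qed
    hence "card ?N \<le> card (R {} \<times> C {} \<union> (\<Union>a\<in>{..<d}. R {a} \<times> C {a}))"
      using fin by (intro card_mono) auto
    also have "\<dots> \<le> card (R {} \<times> C {}) + card (\<Union>a\<in>{..<d}. R {a} \<times> C {a})"
      by (rule card_Un_le)
    also have "\<dots> \<le> (n - d * d - 1) * (n - d * c) + d * (d * c)"
      using card_UN_le_mult[of "{..<d}" "\<lambda>a. R {a} \<times> C {a}" "d * c"] Ra Ca
      by (simp add: R0 C0 card_cartesian_product)
    also have "\<dots> \<le> (n - (d * c + (d choose 2))) * n"
    proof -
      define P where "P = d choose 2"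
      define x where "x = d * c"
      have P: "2 * P + d = d * d"
        unfolding P_def choose_two by (cases d) (auto simp: algebra_simps)
      have "2 * ((d * d + 1) * x + d * x + P * n) = (d * d + 1 + d) * (2 * x) + 2 * P * n"
        by (simp add: algebra_simps)
      also have "\<dots> \<le> (d * d + 1 + d) * n + 2 * P * n"
        using c(1) by (intro add_right_mono mult_left_mono) (auto simp: x_def)
      also have "\<dots> = (2 * P + d + d * d + 1) * n" by (simp add: algebra_simps)
      also have "\<dots> \<le> (2 * (d * d + 1)) * n" unfolding P by (intro mult_right_mono) auto
      finally have *: "(d * d + 1) * x + d * x + P * n \<le> (d * d + 1) * n" by simp
      \<comment> \<open>Name the truncated differences, so that the rest is algebra over the integers.\<close>
      define u v w where "u = n - d * d - 1" and "v = n - x" and "w = n - (x + P)"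
      hence uvw: "n = u + d * d + 1" "n = v + x" "n = w + (x + P)"
        using d sum unfolding x_def P_def by linarith+
      have "int u * int v + int d * int x \<le> int w * int n"
      proof -
        have u: "int u = int n - int d * int d - 1" using arg_cong[OF uvw(1), of int] by simp
        have v: "int v = int n - int x" using arg_cong[OF uvw(2), of int] by simp
        have w: "int w = int n - int x - int P" using arg_cong[OF uvw(3), of int] by simp
        from * have "(int d * int d + 1) * int x + int d * int x + int P * int n \<le> (int d * int d + 1) * int n"
          by (metis of_nat_1 of_nat_add of_nat_le_iff of_nat_mult)
        thus ?thesis unfolding u v w by (simp add: algebra_simps)
      qed
      hence "u * v + d * x \<le> w * n" by (metis of_nat_add of_nat_le_iff of_nat_mult)
      moreover have "n - d * d - 1 = u" "n - x = v" "n - (x + P) = w" using uvw by linarith+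
      ultimately show ?thesis unfolding x_def[symmetric] P_def[symmetric] by simp
    qed
    also have "n - (d * c + (d choose 2)) = card {s \<in> {1..n}. sl s = k}"
      using sl 1 by (simp add: labelling_def)
    finally show ?thesis .
  next
    case (2 a)
    have "?N \<subseteq> R {a} \<times> C {} \<union> R {} \<times> C {a}"
    proof
      fix x assume xN: "x \<in> ?N"
      obtain K L where x: "fst x \<in> R K" "snd x \<in> C L" and KL: "sym_diff K L = {a}"
        using N[OF xN] unfolding 2 by blast
      have "(K = {a} \<and> L = {}) \<or> (K = {} \<and> L = {a})"
        using RK[OF x(1)] CK[OF x(2)] KL by (auto split: if_splits)
      thus "x \<in> R {a} \<times> C {} \<union> R {} \<times> C {a}" using x by (cases x) auto
    qed
    hence "card ?N \<le> card (R {a} \<times> C {} \<union> R {} \<times> C {a})"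
      using fin by (intro card_mono) auto
    also have "\<dots> \<le> card (R {a} \<times> C {}) + card (R {} \<times> C {a})"
      by (rule card_Un_le)
    also have "\<dots> = d * (n - d * c) + (n - d * d - 1) * c"
      using 2 by (simp add: R0 C0 Ra Ca card_cartesian_product)
    also have "\<dots> \<le> c * n"
    proof -
      have "d * n \<le> d * (2 * (d * c) + 2 * d)" using c(2) by (intro mult_left_mono) auto
      also have "\<dots> \<le> 2 * (d * (d * c)) + c" using c(3) by (simp add: algebra_simps)
      finally have *: "d * n \<le> 2 * (d * (d * c)) + c" .
      define u v where "u = n - d * d - 1" and "v = n - d * c"
      hence uv: "n = u + d * d + 1" "n = v + d * c"
        using d sum by linarith+
      have "int d * int v + int u * int c \<le> int c * int n"
      proof -
        have u: "int u = int n - int d * int d - 1" using arg_cong[OF uv(1), of int] by simp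
        have v: "int v = int n - int d * int c" using arg_cong[OF uv(2), of int] by simp
        from * have "int (d * n) \<le> int (2 * (d * (d * c)) + c)" by (simp only: of_nat_le_iff)
        thus ?thesis unfolding u v by (simp add: algebra_simps)
      qed
      hence "d * v + u * c \<le> c * n" by (metis of_nat_add of_nat_le_iff of_nat_mult)
      moreover have "n - d * d - 1 = u" "n - d * c = v" using uv by linarith+
      ultimately show ?thesis by simp
    qed
    also have "c = card {s \<in> {1..n}. sl s = k}"
      using sl 2 by (auto simp: labelling_def labels_1)
    finally show ?thesis .
  next
    case (3 a b)
    have "?N \<subseteq> R {a} \<times> C {b} \<union> R {b} \<times> C {a}"
    proof
      fix x assume xN: "x \<in> ?N"
      obtain K L where x: "fst x \<in> R K" "snd x \<in> C L" and KL: "sym_diff K L = {a, b}"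
        using N[OF xN] unfolding 3 by blast
      have "(K = {a} \<and> L = {b}) \<or> (K = {b} \<and> L = {a})"
        using RK[OF x(1)] CK[OF x(2)] KL 3(3) by (auto simp: doubleton_eq_iff split: if_splits)
      thus "x \<in> R {a} \<times> C {b} \<union> R {b} \<times> C {a}" using x by (cases x) auto
    qed
    hence "card ?N \<le> card (R {a} \<times> C {b} \<union> R {b} \<times> C {a})"
      using fin by (intro card_mono) auto
    also have "\<dots> \<le> card (R {a} \<times> C {b}) + card (R {b} \<times> C {a})"
      by (rule card_Un_le)
    also have "\<dots> \<le> 1 * n"
      using 3 c(1) by (simp add: Ra Ca card_cartesian_product)
    also have "1 * n = card {s \<in> {1..n}. sl s = k} * n"
    proof -
      have "k \<in> labels d 2" using 3 by (simp add: labels_def)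
      thus ?thesis using sl by (simp add: labelling_def)
    qed
    finally show ?thesis .
  next
    case 4
    show ?thesis unfolding 4 by simp
  qed
qed

text \<open>
  The sizes can be met because \<open>4 * d ^ 3 \<le> n\<close> makes \<open>n div (2 * d)\<close> at least \<open>2 * d\<^sup>2\<close>.
\<close>

lemma exists_equi_n_square_with_deficiency:
  assumes d0: "d > 0" and dn: "4 * d ^ 3 \<le> n"
  shows "\<exists>A. equi_n_square n A \<and> (\<forall>T. partial_transversal n A T \<longrightarrow> d \<le> 4 * (n - card T) + 3)"
proof -
  define c where "c = n div (2 * d)"
  have "n mod (2 * d) < 2 * d" "n = (2 * d) * c + n mod (2 * d)"
    using d0 by (simp_all add: c_def)
  hence c1: "2 * (d * c) \<le> n" and c2: "n \<le> 2 * (d * c) + 2 * d" by linarith+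
  have c3: "2 * (d * d) \<le> c"
    unfolding c_def using d0 dn
    by (simp add: less_eq_div_iff_mult_less_eq power3_eq_cube algebra_simps)
  have dc: "c \<le> d * c" using d0 by simp
  have dd: "0 < d * d" using d0 by simp
  have dn': "d * d < n" using c1 c3 dc dd by linarith
  have "2 * (d choose 2) \<le> d * d" unfolding choose_two by (cases d) auto
  hence sum: "d * c + (d choose 2) \<le> n" using c1 c3 dc by linarith
  obtain rl where rl: "labelling n d d 0 rl" using exists_labelling[of d d 0 n] dn' by auto
  obtain cl where cl: "labelling n d c 0 cl" using exists_labelling[of d c 0 n] c1 by auto
  obtain sl where sl: "labelling n d c 1 sl" using exists_labelling[of d c 1 n] sum by auto
  have "card {i \<in> {1..n}. rl i = {}} \<noteq> 0" using rl dn' by (simp add: labelling_def)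
  then obtain q where q: "q \<in> {1..n}" "rl q = {}" by (auto simp: card_eq_0_iff)
  let ?X0 = "({1..n} - {q}) \<times> {1..n}"
  have "\<exists>A. A ` ({1..n} \<times> {1..n}) \<subseteq> {1..n} \<and> (\<forall>s\<in>{1..n}. card {x \<in> {1..n} \<times> {1..n}. A x = s} = n)
      \<and> (\<forall>x\<in>?X0. sl (A x) = sym_diff (rl (fst x)) (cl (snd x)))"
    by (rule exists_balanced_labelled_filling)
      (use card_cells_with_label[OF c1 c2 c3 dn' sum rl cl sl q] in \<open>auto simp: card_cartesian_product\<close>)
  then obtain A0 where A0: "A0 ` ({1..n} \<times> {1..n}) \<subseteq> {1..n}"
    "\<And>s. s \<in> {1..n} \<Longrightarrow> card {x \<in> {1..n} \<times> {1..n}. A0 x = s} = n"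
    "\<And>x. x \<in> ?X0 \<Longrightarrow> sl (A0 x) = sym_diff (rl (fst x)) (cl (snd x))"
    by blast
  define A where "A = (\<lambda>i j. A0 (i, j))"
  have filled: "filled_with_symbols n A"
    using A0(1) unfolding filled_with_symbols_def cells_def A_def by blast
  have "occurrences n A s = n" if "s \<in> {1..n}" for s
  proof -
    have "{(i, j) \<in> cells n. A i j = s} = {x \<in> {1..n} \<times> {1..n}. A0 x = s}"
      by (auto simp: cells_def A_def)
    thus ?thesis using A0(2)[OF that] by (simp add: occurrences_def)
  qed
  hence "equi_n_square n A" using filled by (simp add: equi_n_square_def)
  moreover have "d \<le> 4 * (n - card T) + 3" if T: "partial_transversal n A T" for T
  proof (rule transversal_deficiency[OF T filled, where q = q and rl = rl and cl = cl and sl = sl])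
    show "rl q = {}" by (rule q(2))
    show "finite (rl i) \<and> card (rl i) \<le> 1" if "i \<in> {1..n}" for i
      by (rule labelling_cases[OF rl that]) auto
    show "finite (cl i) \<and> card (cl i) \<le> 1" if "i \<in> {1..n}" for i
      by (rule labelling_cases[OF cl that]) auto
    show "finite (sl i) \<and> card (sl i) \<le> 2" if "i \<in> {1..n}" for i
      by (rule labelling_cases[OF sl that]) auto
    show "sl (A i j) = sym_diff (rl i) (cl j)" if "i \<in> {1..n}" "j \<in> {1..n}" "i \<noteq> q" for i j
      using A0(3)[of "(i, j)"] that by (simp add: A_def)
    show "odd (card {i \<in> {1..n}. a \<in> rl i} + card {j \<in> {1..n}. a \<in> cl j}
                   + card {s \<in> {1..n}. a \<in> sl s})" if a: "a < d" for a
      unfolding labelling_card_containing[OF rl a] labelling_card_containing[OF cl a]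
        labelling_card_containing[OF sl a] using d0 by (cases d) auto
  qed
  ultimately show ?thesis by blast
qed

theorem theorem2:
  shows "\<exists>N::nat. \<forall>n\<ge>N. \<exists>A::array.
           equi_n_square n A \<and>
           \<not> (\<exists>T. partial_transversal n A T \<and> real (card T) > real n - 1 / 42 * ln (real n))"
proof -
  \<comment> \<open>With \<open>d\<close> between \<open>ln n\<close> and \<open>ln n + 1\<close>, the deficiency is at least \<open>(ln n - 3) / 4\<close>, which exceeds
    \<open>ln n / 42\<close> once \<open>ln n \<ge> 4\<close>.\<close>
  have "\<forall>\<^sub>F n in sequentially. 4 * (ln (real n) + 1) ^ 3 \<le> real n \<and> ln (real n) \<ge> 4"
    by (intro eventually_conj; real_asymp)
  then obtain N where N: "\<And>n. n \<ge> N \<Longrightarrow> 4 * (ln (real n) + 1) ^ 3 \<le> real n \<and> ln (real n) \<ge> 4"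
    unfolding eventually_sequentially by blast
  have arith: "C \<le> M - 1 / 42 * L" if "D \<le> 4 * (M - C) + 3" "L \<le> D" "4 \<le> L" for C D L M :: real
    using that by simp
  show ?thesis
  proof (intro exI[of _ N] allI impI)
    fix n :: nat assume "n \<ge> N"
    note n = N[OF this]
    define d where "d = nat \<lceil>ln (real n)\<rceil>"
    have d: "ln (real n) \<le> real d" "real d \<le> ln (real n) + 1"
      using n unfolding d_def by linarith+
    have "4 * real d ^ 3 \<le> 4 * (ln (real n) + 1) ^ 3"
      using d by (intro mult_left_mono power_mono) auto
    also have "\<dots> \<le> real n" using n by blast
    finally have "real (4 * d ^ 3) \<le> real n" by simp
    hence "4 * d ^ 3 \<le> n" by (simp only: of_nat_le_iff)
    moreover have "d > 0" using n d by linarith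
    ultimately obtain A where A: "equi_n_square n A"
      and deficiency: "\<And>T. partial_transversal n A T \<Longrightarrow> d \<le> 4 * (n - card T) + 3"
      using exists_equi_n_square_with_deficiency by blast
    have "real (card T) \<le> real n - 1 / 42 * ln (real n)" if "partial_transversal n A T" for T
    proof -
      have "d \<le> 4 * (n - card T) + 3" "d > 3" using deficiency[OF that] n d by linarith+
      moreover from this have "card T \<le> n" by linarith
      ultimately have "d + 4 * card T \<le> 4 * n + 3" by linarith
      hence "real (d + 4 * card T) \<le> real (4 * n + 3)" by (simp only: of_nat_le_iff)
      hence "real d \<le> 4 * (real n - real (card T)) + 3" by simp
      thus ?thesis using d(1) conjunct2[OF n] by (rule arith)
    qed
    thus "\<exists>A::array. equi_n_square n A \<and>
           \<not> (\<exists>T. partial_transversal n A T \<and> real (card T) > real n - 1 / 42 * ln (real n))"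
      using A by (meson linorder_not_le)
  qed
qed

end
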